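(* There exist constants $\delta_0(d)>0$, $C(\mathscr L,d)>0$, $\mathtt C(\mathscr L,d)>0$, $\mathtt c(d)>1$ such that, for any $0<\delta<\delta_0(d)$, there exists a partition $(\Omega_\alpha)_{\alpha\in A}$ of $\mathbb Z^d$ satisfying: (1) For all $\alpha\in A$ and all $j_1,j_2\in\Omega_\alpha$, $$|j_1-j_2|+|\mu_{j_1}-\mu_{j_2}|\le C(\mathscr L,d)\,(|j_1|+|j_2|)^{\mathtt c(d)\delta}.$$ Moreover each $\Omega_\alpha$ is finite and, either $\max_{j\in\Omega_\alpha}|j|\le\mathtt C(\mathscr L,d)$ or $\max_{j\in\Omega_\alpha}|j|\le2\min_{j\in\Omega_\alpha}|j|$. (2) For all $\alpha,\beta\in A$ with $\alpha\ne\beta$, all $j_1\in\Omega_\alpha$ and all $j_2\in\Omega_\beta$, $$|j_1-j_2|+|\mu_{j_1}-\mu_{j_2}|>(|j_1|+|j_2|)^{\delta}.$$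
   Context: $\mathscr L=\{\sum_{i=1}^d m_i\mathbf v_i: m_i\in\mathbb Z\}$ is an arbitrary lattice of $\mathbb R^d$ with linearly independent generators $\mathbf v_1,\dots,\mathbf v_d\in\mathbb R^d$; $\mathbf V=(\mathbf v_1|\cdots|\mathbf v_d)$ and $W=\mathbf V^{-\top}$ (the transpose of $\mathbf V^{-1}$). For $j\in\mathbb Z^d$, $\mu_j=\|Wj\|^2$, with $\|\cdot\|$ the Euclidean norm (these are the eigenvalues of minus the Laplacian on the flat torus $\mathbb R^d/\mathscr L$, up to rescaling). $|j|=\max(|j_1|,\dots,|j_d|)$. The notation $\delta_0(d)$, $C(\mathscr L,d)$, etc. means that the constants depend only on the indicated quantities. *)

theory Defs
  imports "HOL-Analysis.Analysis" "HOL-Library.Disjoint_Sets"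
begin

text \<open>
  The ambient dimension is the cardinality of the finite index type; integer vectors
  are elements of \<open>int ^ 'n\<close>, and the generators of the lattice form a family
  \<open>v\<close> indexed by the same type.
\<close>

definition real_vec :: "int ^ 'n \<Rightarrow> real ^ 'n" where
  "real_vec j = (\<chi> i. real_of_int (j $ i))"

text \<open>On \<open>real ^ 'n\<close> the library norm \<open>infnorm\<close> is the maximum of the moduli of the coordinates.\<close>

definition max_norm :: "int ^ 'n \<Rightarrow> real" where
  "max_norm j = infnorm (real_vec j)"

definition lin_indep_family :: "('n::finite \<Rightarrow> real ^ 'n) \<Rightarrow> bool" where
  "lin_indep_family v \<longleftrightarrow> inj v \<and> independent (range v)"

text \<open>The generators are the columns of the matrix.\<close>

definition gen_matrix :: "('n::finite \<Rightarrow> real ^ 'n) \<Rightarrow> real ^ 'n ^ 'n" where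
  "gen_matrix v = (\<chi> i k. v k $ i)"

definition dual_matrix :: "('n::finite \<Rightarrow> real ^ 'n) \<Rightarrow> real ^ 'n ^ 'n" where
  "dual_matrix v = transpose (matrix_inv (gen_matrix v))"

definition eigenval :: "('n::finite \<Rightarrow> real ^ 'n) \<Rightarrow> int ^ 'n \<Rightarrow> real" where
  "eigenval v j = (norm (dual_matrix v *v real_vec j))\<^sup>2"

end

theory Submission
  imports Defs
begin

text \<open>
  The blocks are the classes of the transitive closure of the relation
  \<open>|j - k| + |\<mu>\<^sub>j - \<mu>\<^sub>k| \<le> (|j| + |k|)\<^sup>\<delta>\<close>, so (2) is automatic, and (1) amounts to
  Bourgain's bound, polynomial in \<open>\<Gamma>\<close>, on the length of a chain of distinct integer points with
  steps \<open>|j - k| + |\<mu>\<^sub>j - \<mu>\<^sub>k| \<le> \<Gamma>\<close>. That bound is proved by induction on the dimension of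
  the span \<open>G\<close> of the differences. If \<open>l\<close> exceeds the bound for smaller dimension, then every window
  of \<open>l\<close> steps has differences spanning \<open>G\<close>. These are short integer vectors, almost orthogonal to
  the point at which the window starts. By Cramer's rule (a nonzero integer determinant is at least 1)
  they represent every vector of \<open>G\<close> with controlled coefficients; applied to the difference \<open>x\<close> of two
  points of the chain this bounds \<open>\<parallel>Wx\<parallel>\<^sup>2\<close>, hence confines the chain to a small ball, which
  contains few integer points.
\<close>

section \<open>Invertibility of the generator and dual matrices\<close>

lemma invertible_gen_matrix:
  assumes "lin_indep_family v"
  shows "invertible (gen_matrix v)"
proof -
  have inj: "inj v" and ind: "independent (range v)"
    using assms by (auto simp: lin_indep_family_def)
  have "c i = 0" if "(\<Sum>i\<in>UNIV. c i *s column i (gen_matrix v)) = 0" for c i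
  proof -
    \<comment> \<open>Independence is a property of the set \<open>range v\<close>, so the
      coefficient of a vector \<open>b\<close> is read off at its index
      \<open>inv v b\<close>.\<close>
    have "(\<Sum>b\<in>range v. c (inv v b) *\<^sub>R b) = (\<Sum>i\<in>UNIV. c i *\<^sub>R v i)"
      using inj by (simp add: sum.reindex)
    also have "\<dots> = 0"
      using that by (simp add: gen_matrix_def column_def scalar_mult_eq_scaleR)
    finally have "c (inv v (v i)) = 0"
      using ind by (intro independentD[of "range v" "range v"]) auto
    then show ?thesis using inj by simp
  qed
  then show ?thesis
    by (simp add: invertible_left_inverse matrix_left_invertible_independent_columns)
qed

lemma inj_dual_matrix:
  assumes "lin_indep_family v"
  shows "inj ((*v) (dual_matrix v))"
proof (rule inj_matrix_vector_mult)
  \<comment> \<open>\<open>matrix_inv\<close> is a choice of two-sided inverse; its two defining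
    equations, read the other way round, say that it is invertible as well.\<close>
  have "invertible (matrix_inv (gen_matrix v))"
    using someI_ex[OF invertible_gen_matrix[OF assms, unfolded invertible_def]]
    unfolding matrix_inv_def invertible_def by blast
  then show "invertible (dual_matrix v)"
    by (simp add: dual_matrix_def invertible_det_nz)
qed

section \<open>Coefficients with respect to integer vectors\<close>

lemma abs_det_le:
  fixes A :: "real^'n^'n"
  assumes "\<And>i k. \<bar>A $ i $ k\<bar> \<le> M"
  shows "\<bar>det A\<bar> \<le> fact CARD('n) * M ^ CARD('n)"
proof -
  let ?S = "{p. p permutes (UNIV :: 'n set)}"
  have "\<bar>det A\<bar> \<le> (\<Sum>p\<in>?S. \<bar>of_int (sign p) * (\<Prod>i\<in>UNIV. A $ i $ p i)\<bar>)"
    unfolding det_def by (rule sum_abs)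
  also have "\<dots> \<le> (\<Sum>p\<in>?S. M ^ CARD('n))"
  proof (rule sum_mono)
    fix p assume "p \<in> ?S"
    have "\<bar>of_int (sign p) * (\<Prod>i\<in>UNIV. A $ i $ p i)\<bar> = (\<Prod>i\<in>UNIV. \<bar>A $ i $ p i\<bar>)"
      by (simp add: abs_mult abs_prod sign_def)
    also have "\<dots> \<le> (\<Prod>i\<in>(UNIV::'n set). M)"
      using assms by (intro prod_mono) auto
    finally show "\<bar>of_int (sign p) * (\<Prod>i\<in>UNIV. A $ i $ p i)\<bar> \<le> M ^ CARD('n)" by simp
  qed
  also have "\<dots> = fact CARD('n) * M ^ CARD('n)"
    by (simp add: card_permutations)
  finally show ?thesis .
qed

text \<open>By Cramer's rule a coefficient is a quotient of two determinants. The denominator is a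
  nonzero integer, hence at least 1 in modulus. After scaling to
  \<open>infnorm x \<le> 1 \<le> M\<close>, the column replaced in the numerator obeys the same
  entry bound \<open>M\<close> as the others, and homogeneity restores the factor
  \<open>infnorm x\<close>.\<close>

lemma representation_le:
  fixes B :: "(real^'n) set" and M :: real
  assumes ind: "independent B" and span: "span B = UNIV"
    and int: "\<And>b i. b \<in> B \<Longrightarrow> b $ i \<in> \<int>" and le: "\<And>b i. b \<in> B \<Longrightarrow> \<bar>b $ i\<bar> \<le> M"
    and M: "1 \<le> M" and b: "b \<in> B"
  shows "\<bar>representation B x b\<bar> \<le> fact CARD('n) * M ^ CARD('n) * infnorm x"
proof -
  have finB: "finite B" using ind by (rule finiteI_independent)
  have "card B = CARD('n)"
    using dim_unique[of B UNIV "card B"] ind span by simp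
  then obtain f :: "'n \<Rightarrow> real^'n" where f: "bij_betw f UNIV B"
    using finB by (metis finite_class.finite_UNIV finite_same_card_bij)
  let ?F = "gen_matrix f"
  have fB: "f k \<in> B" for k using f by (auto simp: bij_betw_def)
  have "invertible ?F"
    using f ind by (intro invertible_gen_matrix) (auto simp: lin_indep_family_def bij_betw_def)
  then have det0: "det ?F \<noteq> 0" by (simp add: invertible_det_nz)
  have "det ?F \<in> \<int>"
    using int[OF fB] unfolding det_def gen_matrix_def
    by (intro Ints_sum Ints_mult Ints_prod) auto
  with det0 have det1: "1 \<le> \<bar>det ?F\<bar>" by (rule Ints_nonzero_abs_ge1[rotated])
  obtain k where k: "b = f k" using b f by (auto simp: bij_betw_def)
  have unit: "\<bar>representation B y b\<bar> \<le> fact CARD('n) * M ^ CARD('n)" if "infnorm y \<le> 1" for y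
  proof -
    let ?a = "\<chi> k. representation B y (f k)"
    let ?D = "det (\<chi> i j. if j = k then y $ i else ?F $ i $ j)"
    have "?F *v ?a = (\<Sum>k\<in>UNIV. representation B y (f k) *\<^sub>R f k)"
      by (simp add: matrix_mult_sum gen_matrix_def column_def scalar_mult_eq_scaleR)
    also have "\<dots> = (\<Sum>b\<in>B. representation B y b *\<^sub>R b)"
      by (rule sum.reindex_bij_betw[OF f])
    also have "\<dots> = y"
      using ind span finB by (intro real_vector.sum_representation_eq) auto
    finally have "?a = (\<chi> k. det (\<chi> i j. if j = k then y $ i else ?F $ i $ j) / det ?F)"
      using cramer[OF det0] by blast
    then have "?a $ k = ?D / det ?F" by (metis (no_types, lifting) vec_lambda_beta)
    then have "\<bar>representation B y b\<bar> = \<bar>?D\<bar> / \<bar>det ?F\<bar>" using k by (simp add: abs_divide)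
    also have "\<dots> \<le> \<bar>?D\<bar> / 1" using det1 by (intro divide_left_mono) auto
    also have "\<dots> \<le> fact CARD('n) * M ^ CARD('n)"
      unfolding div_by_1
    proof (rule abs_det_le)
      fix i j
      have "\<bar>y $ i\<bar> \<le> M" using component_le_infnorm_cart[of y i] that M by linarith
      then show "\<bar>(\<chi> i j. if j = k then y $ i else ?F $ i $ j) $ i $ j\<bar> \<le> M"
        using le[OF fB] by (simp add: gen_matrix_def)
    qed
    finally show ?thesis .
  qed
  show ?thesis
  proof (cases "x = 0")
    case True
    then show ?thesis by (simp add: representation_zero infnorm_0)
  next
    case False
    then have pos: "infnorm x > 0" by (simp add: infnorm_pos_lt)
    let ?y = "(1 / infnorm x) *\<^sub>R x"
    have "infnorm ?y \<le> 1" using pos by (simp add: infnorm_mul)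
    then have "\<bar>representation B ?y b\<bar> \<le> fact CARD('n) * M ^ CARD('n)" by (rule unit)
    moreover have "representation B x b = infnorm x * representation B ?y b"
      using ind span pos representation_scale[of B x "1 / infnorm x"] by simp
    ultimately show ?thesis using pos by (simp add: abs_mult mult.commute)
  qed
qed

text \<open>Expand \<open>x\<close> in a basis chosen from \<open>S\<close>: there are at most
  \<open>CARD('n)\<close> terms, each a coefficient controlled by Cramer's rule times a value of
  \<open>h\<close> of size at most \<open>T\<close>.\<close>

lemma abs_linear_le_of_span:
  fixes h :: "real^'n \<Rightarrow> real" and M T :: real
  assumes h: "linear h" and x: "x \<in> span S"
    and int: "\<And>b i. b \<in> S \<Longrightarrow> b $ i \<in> \<int>" and le: "\<And>b i. b \<in> S \<Longrightarrow> \<bar>b $ i\<bar> \<le> M"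
    and M: "1 \<le> M" and hS: "\<And>b. b \<in> S \<Longrightarrow> \<bar>h b\<bar> \<le> T"
  shows "\<bar>h x\<bar> \<le> CARD('n) * fact CARD('n) * M ^ CARD('n) * T * infnorm x"
\<comment> \<open>For empty \<open>S\<close> the hypothesis \<open>hS\<close> does not force
  \<open>T\<close> to be nonnegative, but then \<open>x = 0\<close>.\<close>
proof (cases "S = {}")
  case True
  then show ?thesis using x h by (simp add: linear_0 infnorm_0)
next
  case False
  then have T: "0 \<le> T" using hS by fastforce
  obtain S' where S': "S' \<subseteq> S" "independent S'" "S \<subseteq> span S'"
    by (metis maximal_independent_subset)
  have xS': "x \<in> span S'"
    using x S' by (meson in_mono span_minimal subspace_span)
  \<comment> \<open>Completing with unit vectors makes the matrix square while keeping its entries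
    integers of modulus at most \<open>M\<close>. As \<open>x\<close> lies in the span of
    \<open>S'\<close>, its coefficients on \<open>S'\<close> do not change.\<close>
  obtain B where B: "S' \<subseteq> B" "B \<subseteq> S' \<union> Basis" "independent B" "S' \<union> Basis \<subseteq> span B"
    using maximal_independent_subset_extend[of S' "S' \<union> Basis"] S'(2) by blast
  have spanB: "span B = UNIV"
    using B(4) by (metis Un_subset_iff span_Basis span_minimal subspace_span top.extremum_uniqueI)
  have axis: "b $ i \<in> {0, 1}" if "b \<in> Basis" for b :: "real^'n" and i
    using that by (auto simp: Basis_vec_def axis_def)
  have rep: "\<bar>representation S' x b\<bar> \<le> fact CARD('n) * M ^ CARD('n) * infnorm x" if "b \<in> S'" for b
  proof -
    have "representation S' x = representation B x"
      using B xS' by (simp add: representation_extend)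
    moreover have "\<bar>representation B x b\<bar> \<le> fact CARD('n) * M ^ CARD('n) * infnorm x"
    proof (rule representation_le[OF B(3) spanB])
      fix c i assume "c \<in> B"
      then have "c \<in> S \<or> c \<in> Basis" using B(2) S'(1) by blast
      then show "c $ i \<in> \<int>" "\<bar>c $ i\<bar> \<le> M"
        using int le M axis[of c i] by fastforce+
    qed (use M that B(1) in auto)
    ultimately show ?thesis by simp
  qed
  have finS': "finite S'" using S'(2) by (rule finiteI_independent)
  have cardS': "card S' \<le> CARD('n)"
    using independent_card_le[OF S'(2)] by simp
  have "x = (\<Sum>b\<in>S'. representation S' x b *\<^sub>R b)"
    using S'(2) xS' finS' by (simp add: real_vector.sum_representation_eq)
  then have "h x = h (\<Sum>b\<in>S'. representation S' x b *\<^sub>R b)"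
    by (rule arg_cong)
  also have "\<dots> = (\<Sum>b\<in>S'. representation S' x b * h b)"
    by (simp add: linear_sum[OF h] linear_scale[OF h])
  also have "\<bar>\<dots>\<bar> \<le> (\<Sum>b\<in>S'. fact CARD('n) * M ^ CARD('n) * infnorm x * T)"
    using rep hS S'(1) M infnorm_pos_le[of x]
    by (intro order.trans[OF sum_abs] sum_mono) (auto simp: abs_mult intro!: mult_mono)
  also have "\<dots> = card S' * (fact CARD('n) * M ^ CARD('n) * infnorm x * T)" by simp
  also have "\<dots> \<le> CARD('n) * (fact CARD('n) * M ^ CARD('n) * infnorm x * T)"
    using cardS' M T infnorm_pos_le[of x] by (intro mult_right_mono) auto
  finally show ?thesis by (simp add: mult_ac)
qed

section \<open>The maximum norm and integer points in balls\<close>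

lemma infnorm_le_iff:
  fixes x :: "real^'n"
  shows "infnorm x \<le> r \<longleftrightarrow> (\<forall>i. \<bar>x $ i\<bar> \<le> r)"
proof -
  have "(\<lambda>b. \<bar>x \<bullet> b\<bar>) ` Basis = range (\<lambda>i. \<bar>x $ i\<bar>)"
    by (auto simp: Basis_vec_def inner_axis image_iff)
  then show ?thesis by (simp add: infnorm_Max)
qed

lemma max_norm_le_iff: "max_norm j \<le> r \<longleftrightarrow> (\<forall>i. \<bar>real_of_int (j $ i)\<bar> \<le> r)"
  by (simp add: max_norm_def infnorm_le_iff real_vec_def)

lemma
  fixes j\<^sub>0 :: "int^'n" and r :: real
  assumes "0 \<le> r"
  shows finite_max_norm_ball: "finite {j. max_norm (j - j\<^sub>0) \<le> r}" (is "finite ?X")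
    and card_max_norm_ball: "card {j. max_norm (j - j\<^sub>0) \<le> r} \<le> (2 * r + 1) ^ CARD('n)"
proof -
  \<comment> \<open>Integer coordinates of modulus at most \<open>r\<close> are bounded by its
    floor, which leaves at most \<open>2 * r + 1\<close> values each.\<close>
  let ?I = "{- \<lfloor>r\<rfloor>..\<lfloor>r\<rfloor>}"
  let ?f = "\<lambda>j i. (j - j\<^sub>0) $ i"
  have inj: "inj_on ?f ?X"
    by (rule inj_onI) (simp add: vec_eq_iff fun_eq_iff)
  have sub: "?f ` ?X \<subseteq> (\<Pi>\<^sub>E i\<in>UNIV. ?I)"
  proof (rule image_subsetI)
    fix j assume "j \<in> ?X"
    then have "\<bar>real_of_int ((j - j\<^sub>0) $ i)\<bar> \<le> r" for i
      by (simp only: mem_Collect_eq max_norm_le_iff)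
    then have "\<bar>(j - j\<^sub>0) $ i\<bar> \<le> \<lfloor>r\<rfloor>" for i
      by (simp only: le_floor_iff of_int_abs)
    then show "?f j \<in> (\<Pi>\<^sub>E i\<in>UNIV. ?I)"
      by (simp only: PiE_UNIV_domain Pi_iff atLeastAtMost_iff abs_le_iff) (metis minus_le_iff)
  qed
  have fin: "finite (\<Pi>\<^sub>E i\<in>(UNIV::'n set). ?I)" by (intro finite_PiE) auto
  show "finite ?X"
    using finite_imageD[OF finite_subset[OF sub fin] inj] .
  have "card ?X \<le> card (\<Pi>\<^sub>E i\<in>(UNIV::'n set). ?I)"
    by (rule card_inj_on_le[OF inj sub fin])
  also have "\<dots> = nat (2 * \<lfloor>r\<rfloor> + 1) ^ CARD('n)"
    by (simp add: card_PiE)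
  also have "real \<dots> \<le> (2 * r + 1) ^ CARD('n)"
    using assms by (simp add: power_mono)
  finally show "card ?X \<le> (2 * r + 1) ^ CARD('n)" by simp
qed

lemma real_vec_diff: "real_vec (j - k) = real_vec j - real_vec k"
  by (simp add: real_vec_def vec_eq_iff)

lemma max_norm_nonneg: "0 \<le> max_norm j"
  by (simp add: max_norm_def infnorm_pos_le)

lemma max_norm_0: "max_norm 0 = 0"
  by (simp add: max_norm_def real_vec_def infnorm_eq_0 vec_eq_iff)

lemma max_norm_minus_commute: "max_norm (j - k) = max_norm (k - j)"
  by (simp add: max_norm_def real_vec_diff infnorm_sub)

lemma max_norm_triangle: "max_norm (j - l) \<le> max_norm (j - k) + max_norm (k - l)"
  using infnorm_triangle[of "real_vec (j - k)" "real_vec (k - l)"]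
  by (simp add: max_norm_def real_vec_diff)

lemma max_norm_diff_ge: "max_norm j - max_norm k \<le> max_norm (j - k)"
  using absdiff_infnorm[of "real_vec j" "real_vec k"] by (simp add: max_norm_def real_vec_diff)

lemma max_norm_ge_1:
  assumes "j \<noteq> 0"
  shows "1 \<le> max_norm j"
proof -
  obtain i where "j $ i \<noteq> 0" using assms by (auto simp: vec_eq_iff)
  then have "1 \<le> \<bar>real_of_int (j $ i)\<bar>" by linarith
  also have "\<dots> \<le> max_norm j" using max_norm_le_iff[of j "max_norm j"] by simp
  finally show ?thesis .
qed

section \<open>Chains and the space spanned by their differences\<close>

text \<open>Any matrix \<open>A\<close> is allowed, so that the exponent of the chain bound can be
  fixed before the lattice; at \<open>A = dual_matrix v\<close> this is
  \<open>eigenval v\<close>.\<close>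

definition energy :: "real^'n^'n \<Rightarrow> int^'n \<Rightarrow> real" where
  "energy A j = (norm (A *v real_vec j))\<^sup>2"

text \<open>\<open>L\<close> counts steps, so there are \<open>L + 1\<close> points. Their
  distinctness lets a count of integer points in a ball bound \<open>L\<close>.\<close>

definition chain :: "(int^'n \<Rightarrow> real) \<Rightarrow> real \<Rightarrow> nat \<Rightarrow> (nat \<Rightarrow> int^'n) \<Rightarrow> bool" where
  "chain e \<Gamma> L j \<longleftrightarrow> inj_on j {..L} \<and>
     (\<forall>q<L. max_norm (j (Suc q) - j q) + \<bar>e (j (Suc q)) - e (j q)\<bar> \<le> \<Gamma>)"

text \<open>The span contains the difference of any two points of the chain; its dimension is the
  parameter of the induction.\<close>

definition directions :: "nat \<Rightarrow> (nat \<Rightarrow> int^'n) \<Rightarrow> (real^'n) set" where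
  "directions L j = (\<lambda>p. real_vec (j p - j 0)) ` {..L}"

lemma chain_dist:
  assumes "chain e \<Gamma> L j" and "q \<le> L"
  shows "max_norm (j q - j 0) + \<bar>e (j q) - e (j 0)\<bar> \<le> q * \<Gamma>"
  using assms(2)
proof (induction q)
  case 0
  then show ?case by (simp add: max_norm_0)
next
  case (Suc q)
  have "max_norm (j (Suc q) - j q) + \<bar>e (j (Suc q)) - e (j q)\<bar> \<le> \<Gamma>"
    using assms(1) Suc.prems by (auto simp: chain_def)
  with Suc max_norm_triangle[of "j (Suc q)" "j 0" "j q"] show ?case
    by (simp add: algebra_simps)
qed

lemma chain_shift:
  assumes "chain e \<Gamma> L j" and "q + l \<le> L"
  shows "chain e \<Gamma> l (\<lambda>i. j (q + i))"
proof -
  have "inj_on j ((+) q ` {..l})"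
    using assms by (auto simp: chain_def intro: inj_on_subset[of j "{..L}"])
  then have "inj_on (j \<circ> (+) q) {..l}" by (simp add: comp_inj_on)
  then show ?thesis using assms by (auto simp: chain_def comp_def)
qed

lemma directions_shift_in_span:
  assumes "q + l \<le> L"
  shows "directions l (\<lambda>i. j (q + i)) \<subseteq> span (directions L j)"
proof -
  have "real_vec (j (q + p)) - real_vec (j q) \<in> span (directions L j)" if "p \<le> l" for p
  proof -
    have "real_vec (j (q + p)) - real_vec (j q)
        = real_vec (j (q + p) - j 0) - real_vec (j q - j 0)"
      by (simp add: real_vec_diff)
    also have "\<dots> \<in> span (directions L j)"
      using assms that by (intro span_diff span_base) (auto simp: directions_def)
    finally show ?thesis .
  qed
  then show ?thesis by (auto simp: directions_def real_vec_diff)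
qed

section \<open>Confinement of a chain to a ball\<close>

text \<open>Expanding the square gives \<open>energy A k - energy A j\<close> as twice the inner
  product plus the squared norm of \<open>A *v real_vec (k - j)\<close>. The first is at most
  \<open>M\<close>, the last at most \<open>\<Lambda>\<^sup>2 * M\<^sup>2\<close>, and
  \<open>M \<le> M\<^sup>2\<close>. So a short move with a small change of energy is almost
  orthogonal to its starting point.\<close>

lemma energy_inner_le:
  fixes A :: "real^'n^'n" and \<Lambda> M :: real
  assumes \<Lambda>: "\<And>x. norm (A *v x) \<le> \<Lambda> * infnorm x"
    and M: "1 \<le> M" and dist: "max_norm (k - j) + \<bar>energy A k - energy A j\<bar> \<le> M"
  shows "\<bar>(A *v real_vec j) \<bullet> (A *v real_vec (k - j))\<bar> \<le> (1 + \<Lambda>\<^sup>2) * M\<^sup>2"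
proof -
  let ?u = "A *v real_vec j" and ?w = "A *v real_vec (k - j)"
  have "A *v real_vec k = ?u + ?w"
    by (simp add: real_vec_diff matrix_vector_mult_diff_distrib)
  then have eq: "energy A k - energy A j = 2 * (?u \<bullet> ?w) + (norm ?w)\<^sup>2"
    by (simp add: energy_def power2_norm_eq_inner inner_add_left inner_add_right inner_commute)
  have kj: "infnorm (real_vec (k - j)) \<le> M" "\<bar>energy A k - energy A j\<bar> \<le> M"
    using dist max_norm_nonneg[of "k - j"] by (auto simp: max_norm_def)
  have "(norm ?w)\<^sup>2 \<le> (\<Lambda> * infnorm (real_vec (k - j)))\<^sup>2"
    using \<Lambda> by (simp add: power_mono)
  also have "\<dots> \<le> \<Lambda>\<^sup>2 * M\<^sup>2"
    using kj infnorm_pos_le[of "real_vec (k - j)"]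
    by (simp add: power_mult_distrib mult_left_mono power_mono)
  finally have "(norm ?w)\<^sup>2 \<le> \<Lambda>\<^sup>2 * M\<^sup>2" .
  moreover have "M \<le> M\<^sup>2" using M by (simp add: power2_eq_square)
  moreover have "0 \<le> (norm ?w)\<^sup>2" by simp
  moreover have "(1 + \<Lambda>\<^sup>2) * M\<^sup>2 = M\<^sup>2 + \<Lambda>\<^sup>2 * M\<^sup>2" by (simp add: distrib_right)
  ultimately show ?thesis using eq kj M by linarith
qed

text \<open>For the difference \<open>x\<close> of two window starts, pairing with either start is
  bounded on the directions of its own window, hence linearly in \<open>infnorm x\<close> because
  each window spans all directions. The difference of the two pairings is quadratic in
  \<open>x\<close>, so one factor \<open>infnorm x\<close> cancels.\<close>

lemma chain_diameter_le:
  fixes A :: "real^'n^'n" and j :: "nat \<Rightarrow> int^'n" and m \<Lambda> \<Gamma> :: real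
  assumes lo: "0 < m" "\<And>x. m * infnorm x \<le> norm (A *v x)"
    and \<Lambda>: "\<And>x. norm (A *v x) \<le> \<Lambda> * infnorm x"
    and chain: "chain (energy A) \<Gamma> L j" and M: "1 \<le> l * \<Gamma>"
    and window: "\<And>q. q + l \<le> L \<Longrightarrow> directions L j \<subseteq> span (directions l (\<lambda>i. j (q + i)))"
    and q: "q + l \<le> L" "q' + l \<le> L"
  shows "max_norm (j q - j q')
    \<le> 2 * (CARD('n) * fact CARD('n)) * (1 + \<Lambda>\<^sup>2) / m\<^sup>2 * (l * \<Gamma>) ^ (CARD('n) + 2)"
proof -
  define M where "M = l * \<Gamma>"
  define x where "x = real_vec (j q - j q')"
  define h where "h = (\<lambda>q x. (A *v real_vec (j q)) \<bullet> (A *v x))"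
  define T where "T = CARD('n) * fact CARD('n) * M ^ CARD('n) * ((1 + \<Lambda>\<^sup>2) * M\<^sup>2)"
  have \<Gamma>: "0 \<le> \<Gamma>" using M mult_nonneg_nonpos[of "real l" \<Gamma>] by linarith
  have "x = real_vec (j q - j 0) - real_vec (j q' - j 0)"
    by (simp add: x_def real_vec_diff)
  also have "\<dots> \<in> span (directions L j)"
    using q by (intro span_diff span_base) (auto simp: directions_def)
  finally have x: "x \<in> span (directions L j)" .
  have hx: "\<bar>h p x\<bar> \<le> T * infnorm x" if p: "p + l \<le> L" for p
    unfolding T_def
  proof (rule abs_linear_le_of_span[where S = "directions l (\<lambda>i. j (p + i))"])
    show "linear (h p)"
      by (simp add: h_def linear_iff matrix_vector_right_distrib inner_add_right
          matrix_vector_mult_scaleR)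
    show "x \<in> span (directions l (\<lambda>i. j (p + i)))"
      using x window[OF p] by (meson in_mono span_minimal subspace_span)
    show "1 \<le> M" using M by (simp add: M_def)
  next
    fix b assume "b \<in> directions l (\<lambda>i. j (p + i))"
    then obtain i where i: "i \<le> l" and b: "b = real_vec (j (p + i) - j p)"
      by (auto simp: directions_def)
    have "max_norm (j (p + i) - j p) + \<bar>energy A (j (p + i)) - energy A (j p)\<bar> \<le> i * \<Gamma>"
      using chain_dist[OF chain_shift[OF chain p] i] by simp
    also have "\<dots> \<le> M" using i \<Gamma> by (simp add: M_def mult_right_mono)
    finally have dist: "max_norm (j (p + i) - j p)
        + \<bar>energy A (j (p + i)) - energy A (j p)\<bar> \<le> M" .
    show "b $ a \<in> \<int>" for a by (simp add: b real_vec_def)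
    show "\<bar>b $ a\<bar> \<le> M" for a
      using dist component_le_infnorm_cart[of b a] by (simp add: b max_norm_def)
    show "\<bar>h p b\<bar> \<le> (1 + \<Lambda>\<^sup>2) * M\<^sup>2"
      unfolding h_def b using \<Lambda> M dist by (intro energy_inner_le) (auto simp: M_def)
  qed
  have "(m * infnorm x)\<^sup>2 \<le> (norm (A *v x))\<^sup>2"
    using lo infnorm_pos_le[of x] by (intro power_mono) auto
  \<comment> \<open>\<open>x\<close> is itself the difference of the two base points, so subtracting
    the functionals leaves the inner product of \<open>A *v x\<close> with itself.\<close>
  also have "\<dots> = h q x - h q' x"
    by (simp add: h_def x_def real_vec_diff matrix_vector_mult_diff_distrib
        power2_norm_eq_inner inner_diff_left)
  also have "\<dots> \<le> 2 * T * infnorm x"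
    using hx[OF q(1)] hx[OF q(2)] by linarith
  finally have quad: "m\<^sup>2 * infnorm x * infnorm x \<le> 2 * T * infnorm x"
    by (simp add: power2_eq_square mult_ac)
  have "infnorm x \<le> 2 * T / m\<^sup>2"
  proof (cases "x = 0")
    case True
    then show ?thesis using M by (simp add: infnorm_0 T_def M_def)
  next
    case False
    then have "m\<^sup>2 * infnorm x \<le> 2 * T" using quad by (simp add: infnorm_pos_lt)
    then show ?thesis using lo(1) by (simp add: field_simps)
  qed
  also have "2 * T / m\<^sup>2
      = 2 * (CARD('n) * fact CARD('n)) * (1 + \<Lambda>\<^sup>2) / m\<^sup>2 * (l * \<Gamma>) ^ (CARD('n) + 2)"
    unfolding T_def M_def power_add by simp
  finally show ?thesis by (simp only: max_norm_def x_def)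
qed

section \<open>The length of chains, by induction on dimension\<close>

lemma matrix_infnorm_bounds:
  fixes A :: "real^'n^'n"
  assumes "inj ((*v) A)"
  obtains m \<Lambda> :: real where "0 < m" "0 < \<Lambda>" "\<And>x. m * infnorm x \<le> norm (A *v x)"
    "\<And>x. norm (A *v x) \<le> \<Lambda> * infnorm x"
proof -
  obtain m where m: "0 < m" "\<And>x. m * norm x \<le> norm (A *v x)"
    using linear_inj_bounded_below_pos[OF matrix_vector_mul_linear assms] by metis
  obtain B where B: "0 < B" "\<And>x. norm (A *v x) \<le> B * norm x"
    using linear_bounded_pos[OF matrix_vector_mul_linear[of A]] by metis
  show ?thesis
  proof (rule that[of m "B * sqrt DIM(real^'n)"])
    show "0 < B * sqrt DIM(real^'n)" using B by simp
    show "m * infnorm x \<le> norm (A *v x)" for x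
      using m(1) mult_left_mono[OF infnorm_le_norm[of x], of m] m(2)[of x] by linarith
    show "norm (A *v x) \<le> B * sqrt DIM(real^'n) * infnorm x" for x
      using B(1) mult_left_mono[OF norm_le_infnorm[of x], of B] B(2)[of x]
      unfolding mult.assoc by linarith
  qed (use m in auto)
qed

text \<open>The starts of windows are distinct integer points in a ball of radius
  \<open>K * (l * \<Gamma>) ^ (CARD('n) + 2)\<close>, and counting them bounds \<open>L - l\<close>.
  Since \<open>l\<close> is of order \<open>\<Gamma> ^ c\<close>, the radius has order
  \<open>\<Gamma> ^ ((c + 1) * (CARD('n) + 2))\<close>; the count raises this to the power
  \<open>CARD('n)\<close>.\<close>

lemma chain_length_step:
  fixes A :: "real^'n^'n" and m \<Lambda> C K \<Gamma> :: real
  assumes m: "0 < m" "\<And>x. m * infnorm x \<le> norm (A *v x)"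
    and \<Lambda>: "\<And>x. norm (A *v x) \<le> \<Lambda> * infnorm x"
    and C: "1 \<le> C" and short: "\<And>L j. chain (energy A) \<Gamma> L j \<Longrightarrow>
      dim (directions L j) \<le> g \<Longrightarrow> L \<le> C * \<Gamma> ^ c"
    and \<Gamma>: "1 \<le> \<Gamma>" and chain: "chain (energy A) \<Gamma> L j"
    and dim: "dim (directions L j) \<le> Suc g"
  defines K_def: "K \<equiv> 2 * (CARD('n) * fact CARD('n)) * (1 + \<Lambda>\<^sup>2) / m\<^sup>2"
  shows "L \<le> (2 * C + ((2 * K + 1) * (2 * C) ^ (CARD('n) + 2)) ^ CARD('n))
    * \<Gamma> ^ ((c + 1) * (CARD('n) + 2) * CARD('n))"
proof -
  let ?n = "CARD('n)"
  have K: "0 \<le> K" by (simp add: K_def)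
  \<comment> \<open>The least integer above the bound for dimension \<open>g\<close>; as that bound
    is at least 1, \<open>l\<close> is at most twice as large.\<close>
  define l where "l = nat \<lfloor>C * \<Gamma> ^ c\<rfloor> + 1"
  have CG: "1 \<le> C * \<Gamma> ^ c" using C \<Gamma> mult_mono[of 1 C 1 "\<Gamma> ^ c"] one_le_power[of \<Gamma> c] by simp
  have l_gt: "C * \<Gamma> ^ c < l" using CG unfolding l_def by linarith
  have l_le: "l \<le> 2 * C * \<Gamma> ^ c" using CG unfolding l_def by linarith
  have "c * 1 \<le> (c + 1) * ((?n + 2) * ?n)"
    by (intro mult_le_mono) (simp_all add: Suc_le_eq)
  then have exp: "\<Gamma> ^ c \<le> \<Gamma> ^ ((c + 1) * (?n + 2) * ?n)"
    using \<Gamma> by (intro power_increasing) (simp_all only: mult.assoc mult_1_right)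
  have l_le': "l \<le> 2 * C * \<Gamma> ^ ((c + 1) * (?n + 2) * ?n)"
    using l_le mult_left_mono[OF exp, of "2 * C"] C by linarith
  have pos: "0 \<le> ((2 * K + 1) * (2 * C) ^ (?n + 2)) ^ ?n * \<Gamma> ^ ((c + 1) * (?n + 2) * ?n)"
    using K C \<Gamma> by simp
  \<comment> \<open>A chain with fewer than \<open>l\<close> steps contains no window, and the
    summand \<open>2 * C\<close> alone covers it.\<close>
  show ?thesis
  proof (cases "L < l")
    case True
    then show ?thesis using l_le' pos by (simp add: distrib_right)
  next
    case False
    have window: "directions L j \<subseteq> span (directions l (\<lambda>i. j (q + i)))" if q: "q + l \<le> L" for q
    proof -
      let ?W = "directions l (\<lambda>i. j (q + i))"
      \<comment> \<open>A window of dimension at most \<open>g\<close> would have fewer than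
        \<open>l\<close> steps. Its span therefore has dimension at least \<open>g + 1\<close>
        inside a space of dimension at most \<open>g + 1\<close>.\<close>
      have "\<not> dim ?W \<le> g"
        using short[OF chain_shift[OF chain q]] l_gt by linarith
      then have "dim (span (directions L j)) \<le> dim (span ?W)" using dim by simp
      moreover have "span ?W \<subseteq> span (directions L j)"
        by (rule span_minimal[OF directions_shift_in_span[OF q] subspace_span])
      ultimately have "span ?W = span (directions L j)"
        by (intro subspace_dim_equal) auto
      then show ?thesis by (simp add: span_superset)
    qed
    define R where "R = K * (l * \<Gamma>) ^ (?n + 2)"
    have l\<Gamma>: "1 \<le> l * \<Gamma>"
      using mult_mono[of 1 "real l" 1 \<Gamma>] \<Gamma> l_gt CG by simp
    have R: "0 \<le> R" using K l\<Gamma> by (simp add: R_def)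
    \<comment> \<open>Only points that start a full window are confined; the last \<open>l\<close>
      points are paid for by the summand \<open>2 * C\<close>.\<close>
    have "j ` {..L - l} \<subseteq> {k. max_norm (k - j 0) \<le> R}"
    proof clarsimp
      fix q assume "q \<le> L - l"
      then show "max_norm (j q - j 0) \<le> R"
        unfolding R_def K_def using False
        by (intro chain_diameter_le[OF m \<Lambda> chain l\<Gamma> window]) auto
    qed
    moreover have "inj_on j {..L - l}"
      using chain by (auto simp: chain_def inj_on_def)
    ultimately have "card {..L - l} \<le> card {k. max_norm (k - j 0) \<le> R}"
      using finite_max_norm_ball[OF R] by (intro card_inj_on_le)
    then have "real (L - l + 1) \<le> card {k. max_norm (k - j 0) \<le> R}" by simp
    also have "\<dots> \<le> (2 * R + 1) ^ ?n" by (rule card_max_norm_ball[OF R])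
    also have "\<dots> \<le> ((2 * K + 1) * (2 * C) ^ (?n + 2) * (\<Gamma> ^ (c + 1)) ^ (?n + 2)) ^ ?n"
    proof (rule power_mono)
      have "2 * R + 1 \<le> (2 * K + 1) * (l * \<Gamma>) ^ (?n + 2)"
        using one_le_power[OF l\<Gamma>, of "?n + 2"] unfolding R_def distrib_right by linarith
      also have "\<dots> \<le> (2 * K + 1) * (2 * C * \<Gamma> ^ (c + 1)) ^ (?n + 2)"
        using K l\<Gamma> mult_right_mono[OF l_le, of \<Gamma>] \<Gamma>
        by (intro mult_left_mono power_mono) (auto simp: mult_ac)
      finally show "2 * R + 1 \<le> (2 * K + 1) * (2 * C) ^ (?n + 2) * (\<Gamma> ^ (c + 1)) ^ (?n + 2)"
        by (simp add: power_mult_distrib mult_ac)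
    qed (use R in simp)
    also have "\<dots> = ((2 * K + 1) * (2 * C) ^ (?n + 2)) ^ ?n * \<Gamma> ^ ((c + 1) * (?n + 2) * ?n)"
      by (simp only: power_mult_distrib power_mult)
    finally show ?thesis using l_le' False by (simp add: distrib_right)
  qed
qed

text \<open>The exponent is quantified before \<open>A\<close> and only the factor \<open>C\<close>
  after it; this is why the final exponent and the range of \<open>\<delta>\<close> depend on the
  dimension alone. In dimension 0 all points coincide, so distinctness forces
  \<open>L = 0\<close>.\<close>

lemma chain_length_le_dim:
  "\<exists>c::nat. \<forall>A :: real^'n^'n. inj ((*v) A) \<longrightarrow> (\<exists>C\<ge>1::real. \<forall>\<Gamma>\<ge>1. \<forall>L j.
     chain (energy A) \<Gamma> L j \<longrightarrow> dim (directions L j) \<le> g \<longrightarrow> L \<le> C * \<Gamma> ^ c)"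
proof (induction g)
  case 0
  have "real L \<le> 1 * \<Gamma> ^ 0" if "chain (energy A) \<Gamma> L j" "dim (directions L j) \<le> 0"
    for A :: "real^'n^'n" and \<Gamma> L j
  proof -
    have "real_vec (j L - j 0) \<in> directions L j" by (auto simp: directions_def)
    then have "real_vec (j L - j 0) = 0" using that(2) by auto
    then have "j L = j 0" by (simp add: real_vec_def vec_eq_iff)
    then have "L = 0" using that(1) by (simp add: chain_def inj_on_def)
    then show ?thesis by simp
  qed
  then show ?case by (intro exI[of _ 0] allI impI exI[of _ "1::real"] conjI order.refl)
next
  case (Suc g)
  let ?n = "CARD('n)"
  obtain c :: nat where c: "\<forall>A :: real^'n^'n. inj ((*v) A) \<longrightarrow> (\<exists>C\<ge>1::real. \<forall>\<Gamma>\<ge>1. \<forall>L j.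
     chain (energy A) \<Gamma> L j \<longrightarrow> dim (directions L j) \<le> g \<longrightarrow> L \<le> C * \<Gamma> ^ c)"
    using Suc.IH ..
  show ?case
  proof (intro exI[of _ "(c + 1) * (?n + 2) * ?n"] allI impI)
    fix A :: "real^'n^'n" assume A: "inj ((*v) A)"
    obtain m \<Lambda> where m: "0 < m" "\<And>x. m * infnorm x \<le> norm (A *v x)"
      and \<Lambda>: "\<And>x. norm (A *v x) \<le> \<Lambda> * infnorm x"
      by (rule matrix_infnorm_bounds[OF A]) (rule that)
    obtain C :: real where C: "1 \<le> C" and short: "\<forall>\<Gamma>\<ge>1. \<forall>L j. chain (energy A) \<Gamma> L j
        \<longrightarrow> dim (directions L j) \<le> g \<longrightarrow> L \<le> C * \<Gamma> ^ c"
      using c[rule_format, OF A] by (elim exE conjE) (rule that)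
    define K where "K = 2 * (?n * fact ?n) * (1 + \<Lambda>\<^sup>2) / m\<^sup>2"
    define C' where "C' = 2 * C + ((2 * K + 1) * (2 * C) ^ (?n + 2)) ^ ?n"
    have "L \<le> C' * \<Gamma> ^ ((c + 1) * (?n + 2) * ?n)"
      if "1 \<le> \<Gamma>" "chain (energy A) \<Gamma> L j" "dim (directions L j) \<le> Suc g" for \<Gamma> L j
      unfolding C'_def K_def
      by (rule chain_length_step[OF m \<Lambda> C _ that]) (rule short[rule_format, OF that(1)])
    moreover have "1 \<le> C'" using C by (simp add: C'_def K_def add_increasing2)
    ultimately show "\<exists>C\<ge>1::real. \<forall>\<Gamma>\<ge>1. \<forall>L j. chain (energy A) \<Gamma> L j \<longrightarrow>
        dim (directions L j) \<le> Suc g \<longrightarrow> L \<le> C * \<Gamma> ^ ((c + 1) * (?n + 2) * ?n)"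
      by (intro exI[of _ C'] conjI allI impI)
  qed
qed

lemma chain_length_le:
  "\<exists>c::nat. \<forall>A :: real^'n^'n. inj ((*v) A) \<longrightarrow> (\<exists>C\<ge>1::real. \<forall>\<Gamma>\<ge>1. \<forall>L j.
     chain (energy A) \<Gamma> L j \<longrightarrow> L \<le> C * \<Gamma> ^ c)"
proof -
  have "dim (directions L j) \<le> CARD('n)" for L and j :: "nat \<Rightarrow> int^'n"
    using dim_subset_UNIV[of "directions L j"] by simp
  then show ?thesis
    using chain_length_le_dim[of "CARD('n)", where 'n = 'n] by simp
qed

section \<open>Classes of the closeness relation\<close>

text \<open>A path of least length repeats no point, so paths in the closure supply the distinctness
  that chains demand.\<close>

lemma rtrancl_simple_path:
  assumes "(a, b) \<in> r\<^sup>*"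
  obtains L f where "f 0 = a" "f L = b" "inj_on f {..L::nat}" "\<And>i. i < L \<Longrightarrow> (f i, f (Suc i)) \<in> r"
proof -
  define L where "L = (LEAST n. (a, b) \<in> r ^^ n)"
  have "(a, b) \<in> r ^^ L"
    unfolding L_def using rtrancl_imp_relpow[OF assms] by (rule LeastI_ex)
  then obtain f where f: "f 0 = a" "f L = b" "\<forall>i<L. (f i, f (Suc i)) \<in> r"
    by (auto simp: relpow_fun_conv)
  \<comment> \<open>Cutting out the loop from \<open>i\<close> to \<open>k\<close> would leave a
    path of length \<open>i + (L - k) < L\<close>.\<close>
  have "f i \<noteq> f k" if ik: "i < k" "k \<le> L" for i k
  proof
    assume eq: "f i = f k"
    have "(a, f i) \<in> r ^^ i"
      unfolding relpow_fun_conv using f ik by (intro exI[of _ f]) auto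
    moreover have "(f k, b) \<in> r ^^ (L - k)"
      unfolding relpow_fun_conv using f ik by (intro exI[of _ "\<lambda>x. f (k + x)"]) auto
    ultimately have "(a, b) \<in> r ^^ (i + (L - k))"
      using eq by (auto simp: relpow_add)
    then have "L \<le> i + (L - k)" unfolding L_def by (rule Least_le)
    then show False using ik by linarith
  qed
  then have "inj_on f {..L}"
    by (intro inj_onI) (metis atMost_iff linorder_neqE_nat)
  with f show ?thesis by (intro that) auto
qed

text \<open>The inequality is not strict, so its negation is exactly the separation required between
  different blocks.\<close>

definition close_rel :: "(int^'n \<Rightarrow> real) \<Rightarrow> real \<Rightarrow> (int^'n) rel" where
  "close_rel e \<delta> =
     {(j, k). max_norm (j - k) + \<bar>e j - e k\<bar> \<le> (max_norm j + max_norm k) powr \<delta>}"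

lemma sym_close_rel: "sym (close_rel e \<delta>)"
  by (auto simp: sym_def close_rel_def max_norm_minus_commute add.commute abs_minus_commute)

text \<open>For a sum \<open>s\<close> of the norms with \<open>s \<ge> 1\<close>, the jump is at
  most the square root of \<open>s\<close>, hence at most \<open>(s + 1) / 2\<close>. Absorbing half
  of \<open>s\<close> gives \<open>s \<le> 4 * max_norm j + 1 \<le> 6 * R + 1\<close>.\<close>

lemma close_rel_sum_le:
  fixes R \<delta> :: real
  assumes "(j, k) \<in> close_rel e \<delta>" and \<delta>: "\<delta> \<le> 1/2"
    and R: "1 \<le> R" and j: "max_norm j \<le> 3/2 * R"
  shows "max_norm j + max_norm k \<le> 7 * R"
proof (cases "1 \<le> max_norm j + max_norm k")
  case True
  define s where "s = max_norm j + max_norm k"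
  have s: "1 \<le> s" using True by (simp add: s_def)
  have "s powr \<delta> \<le> s powr (1/2)" using s \<delta> by (intro powr_mono) auto
  also have "\<dots> = sqrt s" using s by (simp add: powr_half_sqrt)
  also have "\<dots> \<le> (s + 1) / 2" using arith_geo_mean_sqrt[of s 1] s by simp
  finally have "s powr \<delta> \<le> (s + 1) / 2" .
  moreover have "max_norm (j - k) \<le> s powr \<delta>"
    using assms(1) by (auto simp: close_rel_def s_def)
  moreover have "max_norm k - max_norm j \<le> max_norm (j - k)"
    using max_norm_diff_ge[of k j] by (simp add: max_norm_minus_commute)
  ultimately have "max_norm k - max_norm j \<le> (s + 1) / 2" by linarith
  then have "s \<le> 4 * max_norm j + 1" unfolding s_def by (simp add: field_simps)
  also have "\<dots> \<le> 7 * R" using j R by simp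
  finally show ?thesis unfolding s_def .
qed (use R in simp)

text \<open>A continuity argument along the path: while the points stay within half the initial norm
  \<open>R\<close> of \<open>f 0\<close>, every step is at most \<open>\<Gamma>\<close>, so the path
  is a chain. The length bound then keeps the next point within
  \<open>C * \<Gamma> ^ (N + 1)\<close>, which is again at most \<open>R / 2\<close>.\<close>

lemma close_path_bound:
  fixes f :: "nat \<Rightarrow> int^'n" and C :: real
  assumes chains: "\<forall>\<Gamma>\<ge>1. \<forall>L j. chain e \<Gamma> L j \<longrightarrow> L \<le> C * \<Gamma> ^ N"
    and C: "1 \<le> C" and \<delta>: "0 < \<delta>" "real (N + 1) * \<delta> \<le> 1/2"
    and inj: "inj_on f {..L}" and path: "\<And>i. i < L \<Longrightarrow> (f i, f (Suc i)) \<in> close_rel e \<delta>"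
    and R: "28 * C\<^sup>2 \<le> max_norm (f 0)"
  defines "\<Gamma> \<equiv> (7 * max_norm (f 0)) powr \<delta>"
  shows "p \<le> L \<Longrightarrow> chain e \<Gamma> p f \<and>
    max_norm (f p - f 0) + \<bar>e (f p) - e (f 0)\<bar> \<le> C * (7 * max_norm (f 0)) powr (real (N + 1) * \<delta>) \<and>
    max_norm (f p - f 0) \<le> max_norm (f 0) / 2"
proof (induction p)
  define R where "R = max_norm (f 0)"
  have "1 \<le> C\<^sup>2" using C by simp
  then have R1: "1 \<le> R" using R unfolding R_def by linarith
  have \<Gamma>1: "1 \<le> \<Gamma>" unfolding \<Gamma>_def R_def[symmetric] using R1 \<delta> by (intro ge_one_powr_ge_zero) auto
  have \<Gamma>N: "\<Gamma> ^ (N + 1) = (7 * R) powr (real (N + 1) * \<delta>)"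
    unfolding \<Gamma>_def R_def[symmetric] using R1
    by (subst powr_realpow[symmetric]) (auto simp: powr_powr mult.commute)
  {
    case 0
    show ?case using max_norm_nonneg[of "f 0"] C
      by (simp add: chain_def max_norm_0)
  next
    case (Suc p)
    then have IH: "chain e \<Gamma> p f" "max_norm (f p - f 0) \<le> R / 2" by (auto simp: R_def)
    have fp: "max_norm (f p) \<le> 3/2 * R"
      using IH(2) max_norm_diff_ge[of "f p" "f 0"] by (simp add: R_def)
    have rel: "(f p, f (Suc p)) \<in> close_rel e \<delta>" using path Suc.prems by simp
    have "1 * \<delta> \<le> real (N + 1) * \<delta>" using \<delta>(1) by (intro mult_right_mono) auto
    then have "\<delta> \<le> 1/2" using \<delta>(2) by linarith
    then have sum: "max_norm (f p) + max_norm (f (Suc p)) \<le> 7 * R"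
      using close_rel_sum_le[OF rel _ R1 fp] by simp
    have "max_norm (f (Suc p) - f p) + \<bar>e (f (Suc p)) - e (f p)\<bar>
        \<le> (max_norm (f p) + max_norm (f (Suc p))) powr \<delta>"
      using rel by (simp add: close_rel_def max_norm_minus_commute abs_minus_commute)
    also have "\<dots> \<le> \<Gamma>"
      unfolding \<Gamma>_def R_def[symmetric] using sum \<delta> max_norm_nonneg
      by (intro powr_mono2) (auto intro: add_nonneg_nonneg)
    finally have chain: "chain e \<Gamma> (Suc p) f"
      using IH(1) Suc.prems inj_on_subset[OF inj, of "{..Suc p}"]
      by (auto simp: chain_def less_Suc_eq)
    have "max_norm (f (Suc p) - f 0) + \<bar>e (f (Suc p)) - e (f 0)\<bar> \<le> Suc p * \<Gamma>"
      by (rule chain_dist[OF chain order.refl])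
    \<comment> \<open>The chain bound, applied to the chain just extended, limits the number of
      steps \<open>Suc p\<close>.\<close>
    also have "\<dots> \<le> (C * \<Gamma> ^ N) * \<Gamma>"
      using chains[rule_format, OF \<Gamma>1 chain] \<Gamma>1 by (intro mult_right_mono) auto
    also have "\<dots> = C * (7 * R) powr (real (N + 1) * \<delta>)"
      unfolding \<Gamma>N[symmetric] by simp
    finally have dist: "max_norm (f (Suc p) - f 0) + \<bar>e (f (Suc p)) - e (f 0)\<bar>
      \<le> C * (7 * R) powr (real (N + 1) * \<delta>)" .
    have "(7 * R) powr (real (N + 1) * \<delta>) \<le> (7 * R) powr (1/2)"
      using R1 \<delta> by (intro powr_mono) auto
    also have "\<dots> = sqrt (7 * R)" using R1 by (simp add: powr_half_sqrt)
    finally have "C * (7 * R) powr (real (N + 1) * \<delta>) \<le> C * sqrt (7 * R)"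
      using C by (intro mult_left_mono) auto
    also have "\<dots> = sqrt (C\<^sup>2 * (7 * R))" using C by (simp add: real_sqrt_mult)
    also have "\<dots> \<le> R / 2"
    proof (rule real_le_lsqrt)
      \<comment> \<open>The threshold 28 is 4 times 7: the claim
        \<open>C\<^sup>2 * (7 * R) \<le> (R / 2)\<^sup>2\<close> amounts to
        \<open>28 * C\<^sup>2 \<le> R\<close>.\<close>
      have "28 * C\<^sup>2 * R \<le> R * R"
        using R R1 unfolding R_def by (intro mult_right_mono) auto
      then show "C\<^sup>2 * (7 * R) \<le> (R / 2)\<^sup>2" by (simp add: power2_eq_square)
    qed (use R1 in auto)
    finally show ?case using chain dist by (simp add: R_def)
  }
qed

lemma close_class_bound:
  fixes C :: real
  assumes chains: "\<forall>\<Gamma>\<ge>1. \<forall>L j. chain e \<Gamma> L j \<longrightarrow> L \<le> C * \<Gamma> ^ N"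
    and C: "1 \<le> C" and \<delta>: "0 < \<delta>" "real (N + 1) * \<delta> \<le> 1/2"
    and jk: "(j, k) \<in> (close_rel e \<delta>)\<^sup>*" and R: "28 * C\<^sup>2 \<le> max_norm j"
  shows "max_norm (j - k) + \<bar>e j - e k\<bar> \<le> 7 * C * max_norm j powr (real (N + 1) * \<delta>)"
    and "max_norm j \<le> 2 * max_norm k"
proof -
  obtain L f where f: "f 0 = j" "f L = k" and inj: "inj_on f {..L::nat}"
    and path: "\<And>i. i < L \<Longrightarrow> (f i, f (Suc i)) \<in> close_rel e \<delta>"
    by (rule rtrancl_simple_path[OF jk]) (rule that)
  have *: "max_norm (j - k) + \<bar>e j - e k\<bar> \<le> C * (7 * max_norm j) powr (real (N + 1) * \<delta>)"
    "max_norm (j - k) \<le> max_norm j / 2"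
    using close_path_bound[OF chains C \<delta> inj path _ order.refl] f R
    by (auto simp: max_norm_minus_commute abs_minus_commute)
  have "(7 * max_norm j) powr (real (N + 1) * \<delta>)
      = 7 powr (real (N + 1) * \<delta>) * max_norm j powr (real (N + 1) * \<delta>)"
    by (rule powr_mult)
  also have "\<dots> \<le> 7 powr 1 * max_norm j powr (real (N + 1) * \<delta>)"
    using \<delta> by (intro mult_right_mono powr_mono) auto
  finally have "C * (7 * max_norm j) powr (real (N + 1) * \<delta>)
      \<le> C * (7 * max_norm j powr (real (N + 1) * \<delta>))"
    using C by (intro mult_left_mono) auto
  with *(1) show "max_norm (j - k) + \<bar>e j - e k\<bar>
      \<le> 7 * C * max_norm j powr (real (N + 1) * \<delta>)" by simp
  show "max_norm j \<le> 2 * max_norm k"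
    using *(2) max_norm_diff_ge[of j k] by linarith
qed

text \<open>\<open>K\<close> separates large points, where the path estimate applies, from small
  ones, where crude bounds on norms and energies suffice.\<close>

lemma close_class_properties:
  fixes e :: "int^'n \<Rightarrow> real" and C T \<delta> :: real
  assumes chains: "\<forall>\<Gamma>\<ge>1. \<forall>L j. chain e \<Gamma> L j \<longrightarrow> L \<le> C * \<Gamma> ^ N"
    and C: "1 \<le> C" and \<delta>: "0 < \<delta>" "real (N + 1) * \<delta> \<le> 1/2"
    and T: "\<And>j. 0 \<le> e j" "\<And>j. e j \<le> T * (max_norm j)\<^sup>2" "0 \<le> T"
    and \<Omega>: "\<Omega> \<in> UNIV // (close_rel e \<delta>)\<^sup>*"
  defines "K \<equiv> 28 * C\<^sup>2"
  shows "\<And>j k. j \<in> \<Omega> \<Longrightarrow> k \<in> \<Omega> \<Longrightarrow> max_norm (j - k) + \<bar>e j - e k\<bar>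
      \<le> (7 * C + 2 * K + T * K\<^sup>2) * (max_norm j + max_norm k) powr (real (N + 2) * \<delta>)"
    and "finite \<Omega>"
    and "Max (max_norm ` \<Omega>) \<le> 2 * K \<or> Max (max_norm ` \<Omega>) \<le> 2 * Min (max_norm ` \<Omega>)"
proof -
  have equiv: "equiv UNIV ((close_rel e \<delta>)\<^sup>*)"
    by (intro equivI refl_rtrancl sym_rtrancl sym_close_rel trans_rtrancl) auto
  have rel: "(j, k) \<in> (close_rel e \<delta>)\<^sup>*" if "j \<in> \<Omega>" "k \<in> \<Omega>" for j k
    using in_quotient_imp_in_rel[OF equiv \<Omega>] that by simp
  note bound = close_class_bound[OF chains C \<delta> rel, folded K_def]
  have K: "1 \<le> K" using one_le_power[OF C, of 2] unfolding K_def by linarith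
  have large: "max_norm (j - k) + \<bar>e j - e k\<bar>
      \<le> (7 * C + 2 * K + T * K\<^sup>2) * (max_norm j + max_norm k) powr (real (N + 2) * \<delta>)"
    if jk: "j \<in> \<Omega>" "k \<in> \<Omega>" and j: "K \<le> max_norm j" for j k
  proof -
    \<comment> \<open>Raising \<open>N + 1\<close> to \<open>N + 2\<close> makes the final exponent
      constant exceed 1 even when \<open>N = 0\<close>.\<close>
    have "max_norm j powr (real (N + 1) * \<delta>) \<le> max_norm j powr (real (N + 2) * \<delta>)"
      using j K \<delta>(1) by (intro powr_mono mult_right_mono) auto
    also have "\<dots> \<le> (max_norm j + max_norm k) powr (real (N + 2) * \<delta>)"
      using j K \<delta>(1) max_norm_nonneg[of k] by (intro powr_mono2) auto
    finally have "7 * C * max_norm j powr (real (N + 1) * \<delta>)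
        \<le> (7 * C + 2 * K + T * K\<^sup>2) * (max_norm j + max_norm k) powr (real (N + 2) * \<delta>)"
      using C K T(3) by (intro mult_mono) auto
    with bound(1)[OF jk j] show ?thesis by linarith
  qed
  show "max_norm (j - k) + \<bar>e j - e k\<bar>
      \<le> (7 * C + 2 * K + T * K\<^sup>2) * (max_norm j + max_norm k) powr (real (N + 2) * \<delta>)"
    if jk: "j \<in> \<Omega>" "k \<in> \<Omega>" for j k
  proof -
    consider "K \<le> max_norm j" | "K \<le> max_norm k" | "j = k"
      | "max_norm j < K" "max_norm k < K" "j \<noteq> k" by linarith
    then show ?thesis
    proof cases
      case 1
      then show ?thesis using large jk by blast
    next
      case 2
      then show ?thesis using large[of k j] jk
        by (simp add: max_norm_minus_commute abs_minus_commute add.commute)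
    next
      case 3
      \<comment> \<open>This includes \<open>j = k = 0\<close>, where the right side vanishes
        because \<open>0 powr x = 0\<close>.\<close>
      then show ?thesis using C K T(3) by (simp add: max_norm_0)
    next
      case 4
      \<comment> \<open>Distinct integer points have norms summing to at least 1, so the power is at
        least 1 and a constant bound is enough.\<close>
      have "j \<noteq> 0 \<or> k \<noteq> 0" using 4 by auto
      then have "1 \<le> max_norm j + max_norm k"
        using max_norm_ge_1[of j] max_norm_ge_1[of k] max_norm_nonneg[of j] max_norm_nonneg[of k]
        by linarith
      then have one: "1 \<le> (max_norm j + max_norm k) powr (real (N + 2) * \<delta>)"
        using \<delta>(1) by (intro ge_one_powr_ge_zero) auto
      have small: "e i \<le> T * K\<^sup>2" if "max_norm i < K" for i
        using T(2)[of i] mult_left_mono[OF power_mono[of "max_norm i" K 2] T(3)]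
          max_norm_nonneg[of i] that by linarith
      have "\<bar>e j - e k\<bar> \<le> T * K\<^sup>2"
        using small[of j] small[of k] T(1)[of j] T(1)[of k] 4 by linarith
      moreover have "max_norm (j - k) \<le> 2 * K"
        using max_norm_triangle[of j k 0] max_norm_minus_commute[of 0 k] 4 by simp
      ultimately have "max_norm (j - k) + \<bar>e j - e k\<bar> \<le> (7 * C + 2 * K + T * K\<^sup>2) * 1"
        unfolding mult_1_right using C by linarith
      also have "\<dots> \<le> (7 * C + 2 * K + T * K\<^sup>2)
          * (max_norm j + max_norm k) powr (real (N + 2) * \<delta>)"
        using one C K T(3) by (intro mult_left_mono) auto
      finally show ?thesis .
    qed
  qed
  \<comment> \<open>The path is taken to start at \<open>k\<close>: either \<open>k\<close> is
    small, or every point of the class has at least half its norm.\<close>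
  have ratio: "max_norm k < K \<or> max_norm k \<le> 2 * max_norm j" if "j \<in> \<Omega>" "k \<in> \<Omega>" for j k
    using bound(2)[OF that(2,1)] by linarith
  obtain i where i: "i \<in> \<Omega>"
    using in_quotient_imp_non_empty[OF equiv \<Omega>] by auto
  have "\<Omega> \<subseteq> {k. max_norm (k - 0) \<le> K + 2 * max_norm i}"
    using ratio[OF i] max_norm_nonneg[of i] K by fastforce
  then show fin: "finite \<Omega>"
    by (rule finite_subset) (use K max_norm_nonneg[of i] in \<open>intro finite_max_norm_ball, simp\<close>)
  show "Max (max_norm ` \<Omega>) \<le> 2 * K \<or> Max (max_norm ` \<Omega>) \<le> 2 * Min (max_norm ` \<Omega>)"
  \<comment> \<open>One point below \<open>K\<close> keeps the whole class below
    \<open>2 * K\<close>; otherwise all points are large and comparison with a point of minimal norm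
    gives the factor 2.\<close>
  proof (cases "\<exists>j\<in>\<Omega>. max_norm j < K")
    case True
    then obtain j where j: "j \<in> \<Omega>" "max_norm j < K" by blast
    have "max_norm k \<le> 2 * K" if "k \<in> \<Omega>" for k
      using ratio[OF j(1) that] j(2) K by linarith
    then show ?thesis using fin i by (intro disjI1 Max.boundedI) auto
  next
    case False
    have "Min (max_norm ` \<Omega>) \<in> max_norm ` \<Omega>" using fin i by (intro Min_in) auto
    then obtain j where j: "j \<in> \<Omega>" "Min (max_norm ` \<Omega>) = max_norm j" by auto
    have "max_norm k \<le> 2 * max_norm j" if "k \<in> \<Omega>" for k
      using ratio[OF j(1) that] False that by blast
    then show ?thesis using fin i j by (intro disjI2 Max.boundedI) auto
  qed
qed

section \<open>Choice of the constants and the partition into classes\<close>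

theorem theorem2p1:
  "\<exists>\<delta>\<^sub>0 > (0::real). \<exists>c > (1::real).
    \<forall>v :: 'n::finite \<Rightarrow> real ^ 'n. lin_indep_family v \<longrightarrow>
      (\<exists>C > (0::real). \<exists>K > (0::real).
        \<forall>\<delta>. 0 < \<delta> \<and> \<delta> < \<delta>\<^sub>0 \<longrightarrow>
          (\<exists>P :: (int ^ 'n) set set. partition_on UNIV P \<and>
            (\<forall>\<Omega>\<in>P.
              (\<forall>j\<^sub>1\<in>\<Omega>. \<forall>j\<^sub>2\<in>\<Omega>.
                max_norm (j\<^sub>1 - j\<^sub>2) + \<bar>eigenval v j\<^sub>1 - eigenval v j\<^sub>2\<bar>
                  \<le> C * (max_norm j\<^sub>1 + max_norm j\<^sub>2) powr (c * \<delta>)) \<and>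
              finite \<Omega> \<and>
              (Max (max_norm ` \<Omega>) \<le> K \<or> Max (max_norm ` \<Omega>) \<le> 2 * Min (max_norm ` \<Omega>))) \<and>
            (\<forall>\<Omega>\<in>P. \<forall>\<Omega>'\<in>P. \<Omega> \<noteq> \<Omega>' \<longrightarrow>
              (\<forall>j\<^sub>1\<in>\<Omega>. \<forall>j\<^sub>2\<in>\<Omega>'.
                max_norm (j\<^sub>1 - j\<^sub>2) + \<bar>eigenval v j\<^sub>1 - eigenval v j\<^sub>2\<bar>
                  > (max_norm j\<^sub>1 + max_norm j\<^sub>2) powr \<delta>))))"
proof -
  obtain N :: nat where N: "\<forall>A :: real^'n^'n. inj ((*v) A) \<longrightarrow> (\<exists>C\<ge>1::real. \<forall>\<Gamma>\<ge>1. \<forall>L j.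
     chain (energy A) \<Gamma> L j \<longrightarrow> L \<le> C * \<Gamma> ^ N)"
    using chain_length_le ..
  show ?thesis
  \<comment> \<open>Both witnesses depend only on \<open>N\<close>, which is fixed before
    \<open>v\<close>. This range of \<open>\<delta>\<close> keeps
    \<open>real (N + 1) * \<delta>\<close> at most 1/2, as the path estimate requires.\<close>
  proof (rule exI[of _ "1 / (2 * real (N + 1))"], rule conjI[rotated],
      rule exI[of _ "real (N + 2)"], rule conjI[rotated], intro allI impI)
    fix v :: "'n \<Rightarrow> real^'n"
    assume v: "lin_indep_family v"
    define e where "e = energy (dual_matrix v)"
    have eigenval: "eigenval v = e"
      by (simp add: fun_eq_iff e_def eigenval_def energy_def)
    obtain C :: real where C: "1 \<le> C" and
      chains: "\<forall>\<Gamma>\<ge>1. \<forall>L j. chain e \<Gamma> L j \<longrightarrow> L \<le> C * \<Gamma> ^ N"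
      using N[rule_format, OF inj_dual_matrix[OF v], folded e_def] by (elim exE conjE) (rule that)
    obtain \<Lambda> where \<Lambda>: "\<And>x. norm (dual_matrix v *v x) \<le> \<Lambda> * infnorm x"
      by (rule matrix_infnorm_bounds[OF inj_dual_matrix[OF v]]) (rule that)
    have e_ge: "0 \<le> e j" for j by (simp add: e_def energy_def)
    have e_le: "e j \<le> \<Lambda>\<^sup>2 * (max_norm j)\<^sup>2" for j
      using power_mono[OF \<Lambda>[of "real_vec j"] norm_ge_zero, of 2]
      by (simp add: e_def energy_def max_norm_def power_mult_distrib)
    define K where "K = 28 * C\<^sup>2"
    have K: "0 < K" using C by (simp add: K_def)
    show "\<exists>C>0. \<exists>K>0. \<forall>\<delta>. 0 < \<delta> \<and> \<delta> < 1 / (2 * real (N + 1)) \<longrightarrow>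
      (\<exists>P :: (int ^ 'n) set set. partition_on UNIV P \<and>
        (\<forall>\<Omega>\<in>P.
          (\<forall>j\<^sub>1\<in>\<Omega>. \<forall>j\<^sub>2\<in>\<Omega>.
            max_norm (j\<^sub>1 - j\<^sub>2) + \<bar>eigenval v j\<^sub>1 - eigenval v j\<^sub>2\<bar>
              \<le> C * (max_norm j\<^sub>1 + max_norm j\<^sub>2) powr (real (N + 2) * \<delta>)) \<and>
          finite \<Omega> \<and>
          (Max (max_norm ` \<Omega>) \<le> K \<or> Max (max_norm ` \<Omega>) \<le> 2 * Min (max_norm ` \<Omega>))) \<and>
        (\<forall>\<Omega>\<in>P. \<forall>\<Omega>'\<in>P. \<Omega> \<noteq> \<Omega>' \<longrightarrow>
          (\<forall>j\<^sub>1\<in>\<Omega>. \<forall>j\<^sub>2\<in>\<Omega>'.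
            max_norm (j\<^sub>1 - j\<^sub>2) + \<bar>eigenval v j\<^sub>1 - eigenval v j\<^sub>2\<bar>
              > (max_norm j\<^sub>1 + max_norm j\<^sub>2) powr \<delta>)))"
      unfolding eigenval
    \<comment> \<open>\<open>7 * C\<close> serves pairs with a large point; \<open>2 * K\<close> and
      \<open>\<Lambda>\<^sup>2 * K\<^sup>2\<close> bound the distance and the energy gap of two
      small points.\<close>
    proof (rule exI[of _ "7 * C + 2 * K + \<Lambda>\<^sup>2 * K\<^sup>2"], intro exI[of _ "2 * K"] conjI allI impI)
      show "0 < 7 * C + 2 * K + \<Lambda>\<^sup>2 * K\<^sup>2" using C K by (simp add: add_pos_nonneg)
      show "0 < 2 * K" using K by simp
      fix \<delta> :: real
      assume "0 < \<delta> \<and> \<delta> < 1 / (2 * real (N + 1))"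
      then have \<delta>: "0 < \<delta>" "real (N + 1) * \<delta> \<le> 1/2" by (auto simp: field_simps)
      let ?P = "UNIV // (close_rel e \<delta>)\<^sup>*"
      have equiv: "equiv UNIV ((close_rel e \<delta>)\<^sup>*)"
        by (intro equivI refl_rtrancl sym_rtrancl sym_close_rel trans_rtrancl) auto
      note props = close_class_properties[OF chains C \<delta> e_ge e_le zero_le_power2,
          folded K_def]
      have far: "(max_norm j + max_norm k) powr \<delta> < max_norm (j - k) + \<bar>e j - e k\<bar>"
        if "\<Omega> \<in> ?P" "\<Omega>' \<in> ?P" "\<Omega> \<noteq> \<Omega>'" "j \<in> \<Omega>" "k \<in> \<Omega>'" for \<Omega> \<Omega>' j k
      proof -
        \<comment> \<open>Points of different classes are unrelated even by the closure, hence not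
          close.\<close>
        have "(j, k) \<notin> (close_rel e \<delta>)\<^sup>*"
          using quotient_eq_iff[OF equiv that(1,2,4,5)] that(3) by simp
        then have "(j, k) \<notin> close_rel e \<delta>" by blast
        then show ?thesis by (simp add: close_rel_def)
      qed
      show "\<exists>P. partition_on UNIV P \<and>
        (\<forall>\<Omega>\<in>P.
          (\<forall>j\<^sub>1\<in>\<Omega>. \<forall>j\<^sub>2\<in>\<Omega>. max_norm (j\<^sub>1 - j\<^sub>2) + \<bar>e j\<^sub>1 - e j\<^sub>2\<bar>
              \<le> (7 * C + 2 * K + \<Lambda>\<^sup>2 * K\<^sup>2) * (max_norm j\<^sub>1 + max_norm j\<^sub>2) powr (real (N + 2) * \<delta>)) \<and>
          finite \<Omega> \<and>
          (Max (max_norm ` \<Omega>) \<le> 2 * K \<or> Max (max_norm ` \<Omega>) \<le> 2 * Min (max_norm ` \<Omega>))) \<and>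
        (\<forall>\<Omega>\<in>P. \<forall>\<Omega>'\<in>P. \<Omega> \<noteq> \<Omega>' \<longrightarrow> (\<forall>j\<^sub>1\<in>\<Omega>. \<forall>j\<^sub>2\<in>\<Omega>'.
            (max_norm j\<^sub>1 + max_norm j\<^sub>2) powr \<delta> < max_norm (j\<^sub>1 - j\<^sub>2) + \<bar>e j\<^sub>1 - e j\<^sub>2\<bar>))"
        using partition_on_quotient[OF equiv] props far
        by (intro exI[of _ ?P] conjI ballI impI) assumption+
    qed
  qed (auto simp: field_simps)
qed

end
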